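(* Let $\mathbb{F}$ be any field (finite, real or complex). Let $\mathcal{A}=\{A_1,\ldots,A_D\}$ be a set of $n\times n$ matrices over $\mathbb{F}$ that is $(s,t)$-dimension spreading. Then the $(D,n,n)$-tensor $T^{\mathcal{A}}$ has tensor rank at least $n+t-s$. Furthermore, if $\mathbb{F}$ is $\mathbb{R}$ or $\mathbb{C}$, then the border rank of $T^{\mathcal{A}}$ is also at least $n+t-s$.
   Context: An $(n_1,n_2,n_3)$-tensor over $\mathbb{F}$ is a function $T:[n_1]\times[n_2]\times[n_3]\to\mathbb{F}$. It has rank one if $T(i_1,i_2,i_3)=f_1(i_1)f_2(i_2)f_3(i_3)$ for some functions $f_j:[n_j]\to\mathbb{F}$; the (tensor) rank $R(T)$ is the minimal $r$ such that $T$ is a sum of $r$ rank-one tensors. Over $\mathbb{R}$ or $\mathbb{C}$, the border rank $\underline{R}(T)$ is the smallest $r$ such that there is a sequence of tensors of rank $\le r$ converging to $T$. For a set $\mathcal{A}=\{A_1,\ldots,A_D\}$ of $n\times n$ matrices, $T^{\mathcal{A}}$ is the $(D,n,n)$-tensor $T^{\mathcal{A}}(i,j,k)=(A_i)_{jk}$. A set $\{L_1,\ldots,L_D\}$ of linear maps $\mathbb{F}^n\to\mathbb{F}^n$ (or $n\times n$ matrices) is $(s,t)$-dimension-spreading if for every subspace $U\subseteq\mathbb{F}^n$ with $\dim U\ge s$ we have $\dim\left(\sum_{i=1}^D L_i(U)\right)\ge t$.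
   Formalization: The formal theorem additionally assumes s ≤ n and t ≥ 1; without them the claim fails (the zero matrix is (s,0)-dimension spreading with rank 0 < n−s when s < n, and for s > n the spreading condition is vacuous for every t). *)

theory Defs
  imports "HOL-Analysis.Analysis"
begin

text \<open>The index sets \<open>[n]\<close> are rendered by finite types, \<open>n\<close> being their cardinality.\<close>

type_synonym ('a, 'i, 'j, 'k) tensor = "'i \<Rightarrow> 'j \<Rightarrow> 'k \<Rightarrow> 'a"

definition rank_one :: "('a::field, 'i::finite, 'j::finite, 'k::finite) tensor \<Rightarrow> bool" where
  "rank_one T \<longleftrightarrow> (\<exists>f\<^sub>1 f\<^sub>2 f\<^sub>3. \<forall>i j k. T i j k = f\<^sub>1 i * f\<^sub>2 j * f\<^sub>3 k)"

definition sum_of_rank_ones :: "nat \<Rightarrow> ('a::field, 'i::finite, 'j::finite, 'k::finite) tensor \<Rightarrow> bool" where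
  "sum_of_rank_ones r T \<longleftrightarrow>
    (\<exists>S. (\<forall>p<r. rank_one (S p)) \<and> (\<forall>i j k. T i j k = (\<Sum>p<r. S p i j k)))"

definition tensor_rank :: "('a::field, 'i::finite, 'j::finite, 'k::finite) tensor \<Rightarrow> nat" where
  "tensor_rank T = (LEAST r. sum_of_rank_ones r T)"

text \<open>Convergence is in the product topology on the function space, that is, entrywise.\<close>

definition border_rank ::
    "('a::{field, topological_space}, 'i::finite, 'j::finite, 'k::finite) tensor \<Rightarrow> nat" where
  "border_rank T =
    (LEAST r. \<exists>X :: nat \<Rightarrow> ('a, 'i, 'j, 'k) tensor. (\<forall>m. tensor_rank (X m) \<le> r) \<and> X \<longlonglongrightarrow> T)"

definition matrices_tensor :: "('d::finite \<Rightarrow> 'a::field ^ 'n ^ 'n) \<Rightarrow> ('a, 'd, 'n, 'n) tensor" where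
  "matrices_tensor A = (\<lambda>i j k. A i $ j $ k)"

text \<open>The set whose dimension is taken is the sum of the subspaces \<open>A i (U)\<close>.
  \<open>vec.subspace\<close> and \<open>vec.dim\<close> refer to the scalar field \<open>'a\<close>; in particular, they are
  complex, not real, notions for complex matrices.\<close>

definition dimension_spreading :: "nat \<Rightarrow> nat \<Rightarrow> ('d::finite \<Rightarrow> 'a::field ^ 'n ^ 'n) \<Rightarrow> bool" where
  "dimension_spreading s t A \<longleftrightarrow>
    (\<forall>U. vec.subspace U \<longrightarrow> s \<le> vec.dim U \<longrightarrow>
      t \<le> vec.dim {\<Sum>i\<in>UNIV. A i *v u i |u. \<forall>i. u i \<in> U})"

text \<open>The minima defining the two ranks range over nonempty sets.\<close>

lemma ex_sum_of_rank_ones: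
  fixes T :: "('a::field, 'i::finite, 'j::finite, 'k::finite) tensor"
  shows "\<exists>r. sum_of_rank_ones r T"
proof -
  obtain f :: "nat \<Rightarrow> 'i \<times> 'j \<times> 'k" where f: "bij_betw f {0..<CARD('i \<times> 'j \<times> 'k)} UNIV"
    using ex_bij_betw_nat_finite[of "UNIV :: ('i \<times> 'j \<times> 'k) set"] by auto
  define S where "S p i j k = (if f p = (i, j, k) then T i j k else 0)" for p i j k
  have "rank_one (S p)" for p
  proof -
    obtain a b c where abc: "f p = (a, b, c)" by (cases "f p") auto
    show ?thesis
      unfolding rank_one_def
      by (rule exI[of _ "\<lambda>i. if i = a then T a b c else 0"],
          rule exI[of _ "\<lambda>j. if j = b then 1 else 0"],
          rule exI[of _ "\<lambda>k. if k = c then 1 else 0"]) (auto simp: S_def abc)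
  qed
  moreover have "T i j k = (\<Sum>p<CARD('i \<times> 'j \<times> 'k). S p i j k)" for i j k
  proof -
    have "(\<Sum>p<CARD('i \<times> 'j \<times> 'k). S p i j k)
        = (\<Sum>q\<in>UNIV. if q = (i, j, k) then T i j k else 0)"
      unfolding S_def lessThan_atLeast0 by (rule sum.reindex_bij_betw[OF f])
    then show ?thesis by simp
  qed
  ultimately show ?thesis unfolding sum_of_rank_ones_def by blast
qed

lemma ex_border_rank_bound:
  fixes T :: "('a::{field, topological_space}, 'i::finite, 'j::finite, 'k::finite) tensor"
  shows "\<exists>r. \<exists>X :: nat \<Rightarrow> ('a, 'i, 'j, 'k) tensor. (\<forall>m. tensor_rank (X m) \<le> r) \<and> X \<longlonglongrightarrow> T"
  by (rule exI[of _ "tensor_rank T"], rule exI[of _ "\<lambda>_. T"]) simp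

end

theory Submission imports Defs begin

text \<open>
  If \<open>T\<close> is a sum of \<open>r\<close> rank-one tensors \<open>f\<^sub>p \<otimes> g\<^sub>p \<otimes> h\<^sub>p\<close>, then
  \<open>A\<^sub>i u = (\<Sum>p. f\<^sub>p(i) \<langle>h\<^sub>p, u\<rangle> g\<^sub>p)\<close>. On the common kernel \<open>U\<close> of \<open>n - s\<close> of the
  functionals \<open>h\<^sub>p\<close>, which has dimension at least \<open>s\<close>, only \<open>r - (n - s)\<close> of the vectors \<open>g\<^sub>p\<close>
  contribute, so the sum of the \<open>A\<^sub>i(U)\<close> has dimension at most \<open>r - (n - s)\<close>. For the border rank,
  the kernels \<open>U\<^sub>m\<close> belonging to the approximating tensors subconverge to a subspace \<open>U\<close> of
  dimension \<open>s\<close> by compactness, and the dimension of the sum of the images is lower semicontinuous.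
\<close>

section \<open>Tensor rank\<close>

text \<open>If \<open>f\<close> is nonzero at some \<open>x\<^sub>0\<close> in \<open>U\<close>,
  subtracting a multiple of \<open>x\<^sub>0\<close> moves any vector of \<open>U\<close> into the
  kernel of \<open>f\<close> on \<open>U\<close>, so this kernel and \<open>x\<^sub>0\<close>
  together span \<open>U\<close>.\<close>

lemma dim_subspace_le_kernel_Suc:
  fixes U :: "('a::field ^ 'n) set" and f :: "'a ^ 'n \<Rightarrow> 'a"
  assumes U: "vec.subspace U"
    and add: "\<And>x y. f (x + y) = f x + f y" and scale: "\<And>c x. f (c *s x) = c * f x"
  shows "vec.dim U \<le> Suc (vec.dim {x \<in> U. f x = 0})"
proof (cases "\<exists>x\<^sub>0\<in>U. f x\<^sub>0 \<noteq> 0")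
  case True
  then obtain x\<^sub>0 where x0: "x\<^sub>0 \<in> U" "f x\<^sub>0 \<noteq> 0" by blast
  have diff: "f (x - y) = f x - f y" for x y
    using add[of "x - y" y] by simp
  have "x \<in> vec.span (insert x\<^sub>0 {x \<in> U. f x = 0})" if "x \<in> U" for x
  proof -
    have "x - (f x / f x\<^sub>0) *s x\<^sub>0 \<in> {x \<in> U. f x = 0}"
      using that x0 U by (simp add: diff scale vec.subspace_diff vec.subspace_scale)
    then show ?thesis
      unfolding vec.span_breakdown_eq by (blast intro: vec.span_base)
  qed
  then have "vec.dim U \<le> vec.dim (insert x\<^sub>0 {x \<in> U. f x = 0})"
    by (intro vec.dim_mono) blast
  also have "\<dots> \<le> Suc (vec.dim {x \<in> U. f x = 0})"
    by (simp add: vec.dim_insert)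
  finally show ?thesis .
next
  case False
  then have "{x \<in> U. f x = 0} = U" by blast
  then show ?thesis by simp
qed

text \<open>Each further functional cuts the dimension by at most one. The functionals may be
  dependent, hence only an inequality.\<close>

lemma dim_common_kernel:
  fixes h :: "nat \<Rightarrow> 'n::finite \<Rightarrow> 'a::field"
  defines "K \<equiv> \<lambda>q. {x :: 'a ^ 'n. \<forall>p<q. (\<Sum>k\<in>UNIV. h p k * x $ k) = 0}"
  shows "vec.subspace (K q)" and "CARD('n) \<le> vec.dim (K q) + q"
proof -
  have sub: "vec.subspace (K q)" for q
    by (auto simp: K_def vec.subspace_def distrib_left sum.distrib sum_distrib_left[symmetric]
        mult.left_commute)
  then show "vec.subspace (K q)" .
  show "CARD('n) \<le> vec.dim (K q) + q"
  proof (induction q)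
    case 0
    have "K 0 = UNIV" by (simp add: K_def)
    then show ?case by (simp add: card_cart_basis)
  next
    case (Suc q)
    have "vec.dim (K q) \<le> Suc (vec.dim {x \<in> K q. (\<Sum>k\<in>UNIV. h q k * x $ k) = 0})"
      by (rule dim_subspace_le_kernel_Suc[OF sub])
        (simp_all add: distrib_left sum.distrib sum_distrib_left mult.left_commute)
    also have "{x \<in> K q. (\<Sum>k\<in>UNIV. h q k * x $ k) = 0} = K (Suc q)"
      by (auto simp: K_def less_Suc_eq)
    finally show ?case using Suc by simp
  qed
qed

text \<open>Spreading is kept out of the hypotheses: the border rank argument applies this to
  approximating tensors, whose matrices may fail to be spreading.\<close>

lemma sum_of_rank_ones_imp_small_image:
  fixes A :: "'d::finite \<Rightarrow> 'a::field ^ 'n ^ 'n"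
  assumes "sum_of_rank_ones r (matrices_tensor A)" and s: "s \<le> CARD('n)"
  obtains U where "vec.subspace U" "s \<le> vec.dim U"
    "vec.dim {\<Sum>i\<in>UNIV. A i *v u i |u. \<forall>i. u i \<in> U} \<le> r - (CARD('n) - s)"
proof -
  obtain S where S: "\<And>p. p < r \<Longrightarrow> rank_one (S p)"
    and T: "\<And>i j k. matrices_tensor A i j k = (\<Sum>p<r. S p i j k)"
    using assms(1) unfolding sum_of_rank_ones_def by blast
  obtain f g h where "\<And>p i j k. p < r \<Longrightarrow> S p i j k = f p i * g p j * h p k"
    using S unfolding rank_one_def by metis
  then have A: "A i $ j $ k = (\<Sum>p<r. f p i * g p j * h p k)" for i j k
    using T by (simp add: matrices_tensor_def)
  define q where "q = CARD('n) - s"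
  \<comment> \<open>If \<open>q > r\<close>, the values \<open>h p\<close> with
    \<open>p \<ge> r\<close> are arbitrary; the \<open>q\<close> conditions still leave dimension at
    least \<open>s\<close>.\<close>
  define U where "U = {x :: 'a ^ 'n. \<forall>p<q. (\<Sum>k\<in>UNIV. h p k * x $ k) = 0}"
  define G where "G p = (\<chi> j. g p j)" for p
  have im: "A i *v u \<in> vec.span (G ` {q..<r})" if u: "u \<in> U" for i u
  proof -
    have "A i *v u = (\<Sum>p<r. (f p i * (\<Sum>k\<in>UNIV. h p k * u $ k)) *s G p)"
    proof (rule vec_eq_iff[THEN iffD2], intro allI)
      fix j
      have "(A i *v u) $ j = (\<Sum>k\<in>UNIV. \<Sum>p<r. f p i * g p j * h p k * u $ k)"
        by (simp add: matrix_vector_mult_def A sum_distrib_right)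
      also have "\<dots> = (\<Sum>p<r. \<Sum>k\<in>UNIV. f p i * g p j * h p k * u $ k)"
        by (rule sum.swap)
      also have "\<dots> = (\<Sum>p<r. (f p i * (\<Sum>k\<in>UNIV. h p k * u $ k)) *s G p) $ j"
        by (simp add: G_def sum_distrib_left sum_distrib_right mult_ac)
      finally show "(A i *v u) $ j = \<dots>" .
    qed
    also have "\<dots> \<in> vec.span (G ` {q..<r})"
    proof (rule vec.span_sum)
      fix p assume "p \<in> {..<r}"
      \<comment> \<open>Terms with \<open>p < q\<close> vanish on \<open>U\<close>; the others are
        multiples of a retained \<open>G p\<close>. If \<open>r \<le> q\<close>, only the first kind
        occurs.\<close>
      then consider "p < q" | "G p \<in> G ` {q..<r}" by fastforce
      then show "(f p i * (\<Sum>k\<in>UNIV. h p k * u $ k)) *s G p \<in> vec.span (G ` {q..<r})"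
      proof cases
        case 1
        then show ?thesis using u by (simp add: U_def vec.span_zero)
      next
        case 2
        then show ?thesis by (intro vec.span_scale vec.span_base)
      qed
    qed
    finally show ?thesis .
  qed
  show thesis
  proof
    show "vec.subspace U"
      unfolding U_def by (rule dim_common_kernel)
    show "s \<le> vec.dim U"
      using dim_common_kernel(2)[where h = h and q = q] s by (simp add: U_def q_def)
    have "vec.dim {\<Sum>i\<in>UNIV. A i *v u i |u. \<forall>i. u i \<in> U} \<le> card (G ` {q..<r})"
      by (rule vec.dim_le_card) (auto intro!: vec.span_sum im)
    also have "\<dots> \<le> r - q"
      using card_image_le[of "{q..<r}" G] by simp
    finally show "vec.dim {\<Sum>i\<in>UNIV. A i *v u i |u. \<forall>i. u i \<in> U} \<le> r - (CARD('n) - s)"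
      by (simp add: q_def)
  qed
qed

lemma sum_of_rank_ones_tensor_rank: "sum_of_rank_ones (tensor_rank T) T"
  unfolding tensor_rank_def by (rule LeastI_ex[OF ex_sum_of_rank_ones])

lemma dimension_spreading_imp_tensor_rank_ge:
  fixes A :: "'d::finite \<Rightarrow> 'a::field ^ 'n ^ 'n"
  assumes "dimension_spreading s t A" "s \<le> CARD('n)" "0 < t"
  shows "CARD('n) + t \<le> tensor_rank (matrices_tensor A) + s"
proof -
  obtain U where "vec.subspace U" "s \<le> vec.dim U"
    "vec.dim {\<Sum>i\<in>UNIV. A i *v u i |u. \<forall>i. u i \<in> U}
      \<le> tensor_rank (matrices_tensor A) - (CARD('n) - s)"
    using sum_of_rank_ones_imp_small_image[OF sum_of_rank_ones_tensor_rank assms(2)] by blast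
  moreover from this have "t \<le> vec.dim {\<Sum>i\<in>UNIV. A i *v u i |u. \<forall>i. u i \<in> U}"
    using assms(1) by (simp add: dimension_spreading_def)
  \<comment> \<open>\<open>0 < t\<close> excludes truncation: a rank of at most
    \<open>CARD('n) - s\<close> would make the natural-number difference \<open>0\<close>, forcing
    \<open>t = 0\<close>.\<close>
  ultimately show ?thesis using assms(2,3) by linarith
qed

section \<open>Limits of subspaces\<close>

lemma tendsto_vector_smult:
  fixes x :: "'b \<Rightarrow> 'a::real_normed_field ^ 'n"
  assumes "(x \<longlongrightarrow> l) F"
  shows "((\<lambda>m. c *s x m) \<longlongrightarrow> c *s l) F"
  by (rule vec_tendstoI) (auto intro!: tendsto_intros assms)

lemma tendsto_matrix_vector_mult:
  fixes A :: "'b \<Rightarrow> 'a::real_normed_field ^ 'n ^ 'k"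
  assumes "\<And>i j. ((\<lambda>m. A m $ i $ j) \<longlongrightarrow> L $ i $ j) F" and "(x \<longlongrightarrow> l) F"
  shows "((\<lambda>m. A m *v x m) \<longlongrightarrow> L *v l) F"
  by (rule vec_tendstoI) (auto simp: matrix_vector_mult_def intro!: tendsto_intros assms)

text \<open>By induction on \<open>s\<close>: each stage passes to a further subsequence and adds
  one limit direction outside the limit space found so far.\<close>

lemma subspace_sequence_subconverges:
  fixes U :: "nat \<Rightarrow> ('a::{real_normed_field,heine_borel} ^ 'n) set"
  assumes "\<And>m. vec.subspace (U m)" and "\<And>m. s \<le> vec.dim (U m)"
  obtains \<sigma> V where "strict_mono (\<sigma> :: nat \<Rightarrow> nat)" "vec.subspace V" "vec.dim V = s"
    "\<forall>v\<in>V. \<exists>x. (\<forall>m. x m \<in> U (\<sigma> m)) \<and> x \<longlonglongrightarrow> v"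
proof -
  have "\<exists>\<sigma> V. strict_mono (\<sigma> :: nat \<Rightarrow> nat) \<and> vec.subspace V \<and> vec.dim V = s \<and>
      (\<forall>v\<in>V. \<exists>x. (\<forall>m. x m \<in> U (\<sigma> m)) \<and> x \<longlonglongrightarrow> v)"
    using assms(2)
  proof (induction s)
    case 0
    show ?case
      by (rule exI[of _ id], rule exI[of _ "{0}"])
        (auto simp: strict_mono_def intro!: exI[of _ "\<lambda>_. 0"] vec.subspace_0[OF assms(1)])
  next
    case (Suc s)
    have "\<And>m. s \<le> vec.dim (U m)" using Suc.prems Suc_leD by blast
    then obtain \<sigma> V where \<sigma>: "strict_mono (\<sigma> :: nat \<Rightarrow> nat)" and V: "vec.subspace V" "vec.dim V = s"
      and lim: "\<And>v. v \<in> V \<Longrightarrow> \<exists>x. (\<forall>m. x m \<in> U (\<sigma> m)) \<and> x \<longlonglongrightarrow> v"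
      using Suc.IH by blast
    \<comment> \<open>A unit vector of \<open>U (\<sigma> m)\<close> in the kernel of a projection \<open>g\<close> onto \<open>V\<close> stays away from
      \<open>V\<close> in the limit.\<close>
    obtain g where g: "range g \<subseteq> V" "Vector_Spaces.linear (*s) (*s) g" "\<And>v. v \<in> V \<Longrightarrow> g v = v"
      using vec.linear_exists_left_inverse_on[OF vec.linear_id V(1)] by auto
    interpret g: Vector_Spaces.linear "(*s)" "(*s)" g by (rule g(2))
    have "\<exists>x \<in> U (\<sigma> m). norm x = 1 \<and> g x = 0" for m
    proof -
      \<comment> \<open>\<open>U (\<sigma> m)\<close> has dimension at least \<open>Suc s\<close>,
        while \<open>g\<close> maps into \<open>V\<close>, of dimension \<open>s\<close>.\<close>
      have "\<not> inj_on g (U (\<sigma> m))"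
      proof
        assume "inj_on g (U (\<sigma> m))"
        then have "vec.dim (g ` U (\<sigma> m)) = vec.dim (U (\<sigma> m))"
          using assms(1) by (intro vec.dim_image_eq[OF g(2)]) (simp add: vec.span_eq_iff[THEN iffD2])
        moreover have "vec.dim (g ` U (\<sigma> m)) \<le> vec.dim V"
          using g(1) by (intro vec.dim_subset) blast
        ultimately show False using Suc.prems[of "\<sigma> m"] V(2) by simp
      qed
      then obtain y z where "y \<in> U (\<sigma> m)" "z \<in> U (\<sigma> m)" "y \<noteq> z" "g y = g z"
        unfolding inj_on_def by blast
      then have w: "y - z \<in> U (\<sigma> m)" "y - z \<noteq> 0" "g (y - z) = 0"
        using assms(1) by (auto simp: vec.subspace_diff g.diff)
      \<comment> \<open>With \<open>of_real\<close> the normalization is a scaling by a field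
        element, under which the subspace is closed; rewritten with \<open>*\<^sub>R\<close>, it
        yields the norm.\<close>
      define x where "x = (of_real (inverse (norm (y - z))) :: 'a) *s (y - z)"
      have "x = inverse (norm (y - z)) *\<^sub>R (y - z)"
        by (simp add: x_def vec_eq_iff scaleR_conv_of_real[where 'a = 'a] right_diff_distrib)
      then have "norm x = 1" using w(2) by simp
      moreover have "x \<in> U (\<sigma> m)" "g x = 0"
        unfolding x_def using vec.subspace_scale[OF assms(1) w(1)] w(3) by (simp_all only: g.scale vec.scale_zero_right)
      ultimately show ?thesis by blast
    qed
    then obtain x where x: "\<And>m. x m \<in> U (\<sigma> m)" "\<And>m. norm (x m) = 1" "\<And>m. g (x m) = 0"
      by metis
    have "compact (sphere (0 :: 'a ^ 'n) 1)" by (rule compact_sphere)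
    then obtain v \<rho> where v: "v \<in> sphere (0 :: 'a ^ 'n) 1" and \<rho>: "strict_mono (\<rho> :: nat \<Rightarrow> nat)"
      and xv: "(x \<circ> \<rho>) \<longlonglongrightarrow> v"
      using x(2) unfolding compact_def by (metis mem_sphere_0)
    \<comment> \<open>As multiplication by a matrix, \<open>g\<close> is continuous, so the limit
      \<open>v\<close> stays in its kernel. Since \<open>g\<close> fixes \<open>V\<close> and
      \<open>v\<close> is a unit vector, \<open>v\<close> lies outside \<open>V\<close>.\<close>
    have "(\<lambda>m. matrix g *v (x \<circ> \<rho>) m) \<longlonglongrightarrow> matrix g *v v"
      by (intro tendsto_matrix_vector_mult tendsto_const xv)
    then have "g v = 0"
      by (simp add: matrix_works[OF g(2)] x(3) LIMSEQ_const_iff)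
    then have "v \<notin> V" using g(3) v by auto
    then have "vec.dim (insert v V) = Suc s"
      using V by (simp add: vec.dim_insert vec.span_eq_iff[THEN iffD2])
    moreover have "\<exists>y. (\<forall>m. y m \<in> U ((\<sigma> \<circ> \<rho>) m)) \<and> y \<longlonglongrightarrow> u" if u: "u \<in> vec.span (insert v V)" for u
    proof -
      \<comment> \<open>The part of \<open>u\<close> in \<open>V\<close> is approximated by the
        induction hypothesis, the multiple of \<open>v\<close> by \<open>x\<close>, both along
        \<open>\<rho>\<close>.\<close>
      obtain k where "u - k *s v \<in> V"
        using u V(1) by (auto simp: vec.span_breakdown_eq vec.span_eq_iff[THEN iffD2])
      then obtain y where y: "\<And>m. y m \<in> U (\<sigma> m)" "y \<longlonglongrightarrow> u - k *s v"
        using lim by blast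
      have "(\<lambda>m. (y \<circ> \<rho>) m + k *s (x \<circ> \<rho>) m) \<longlonglongrightarrow> (u - k *s v) + k *s v"
        by (intro tendsto_add tendsto_vector_smult xv LIMSEQ_subseq_LIMSEQ[OF y(2) \<rho>])
      moreover have "(y \<circ> \<rho>) m + k *s (x \<circ> \<rho>) m \<in> U ((\<sigma> \<circ> \<rho>) m)" for m
        using x(1) y(1) assms(1) by (simp add: vec.subspace_add vec.subspace_scale)
      ultimately show ?thesis
        by (intro exI[of _ "\<lambda>m. (y \<circ> \<rho>) m + k *s (x \<circ> \<rho>) m"]) simp
    qed
    ultimately show ?case
      using strict_mono_o[OF \<sigma> \<rho>, unfolded o_def]
      by (intro exI[of _ "\<sigma> \<circ> \<rho>"] exI[of _ "vec.span (insert v V)"]) auto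
  qed
  then show thesis using that by blast
qed

lemma tendsto_det:
  fixes A :: "'b \<Rightarrow> 'a::real_normed_field ^ 'n ^ 'n"
  assumes "\<And>i j. ((\<lambda>m. A m $ i $ j) \<longlongrightarrow> L $ i $ j) F"
  shows "((\<lambda>m. det (A m)) \<longlongrightarrow> det L) F"
  unfolding det_def by (intro tendsto_intros assms)

text \<open>A basis of \<open>W\<close>, extended to the whole space, is perturbed into
  \<open>X m\<close> by linear maps tending to the identity. Their determinants tend to
  \<open>1\<close>, so some map is injective and carries the basis of \<open>W\<close> to
  independent vectors of \<open>X m\<close>.\<close>

lemma dim_lower_semicontinuous:
  fixes W :: "('a::real_normed_field ^ 'n) set"
  assumes lim: "\<And>w. w \<in> W \<Longrightarrow> \<exists>x. (\<forall>m. x m \<in> X m) \<and> x \<longlonglongrightarrow> w"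
  shows "\<exists>m :: nat. vec.dim W \<le> vec.dim (X m)"
proof -
  obtain B where B: "B \<subseteq> W" "vec.independent B" "W \<subseteq> vec.span B" "card B = vec.dim W"
    using vec.basis_exists by blast
  define C where "C = vec.extend_basis B"
  have C: "B \<subseteq> C" "vec.independent C" "vec.span C = UNIV"
    unfolding C_def
    using vec.extend_basis_superset[OF B(2)] vec.independent_extend_basis[OF B(2)]
      vec.span_extend_basis[OF B(2)] by auto
  obtain x where x: "\<And>w m. w \<in> W \<Longrightarrow> x w m \<in> X m" "\<And>w. w \<in> W \<Longrightarrow> x w \<longlonglongrightarrow> w"
    using lim by metis
  \<comment> \<open>The added basis vectors stay fixed; only those from \<open>W\<close>
    move.\<close>
  define y where "y m b = (if b \<in> B then x b m else b)" for m b
  have y: "(\<lambda>m. y m b) \<longlonglongrightarrow> b" for b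
    using x(2) B(1) by (cases "b \<in> B") (auto simp: y_def)
  define \<phi> where "\<phi> m = vec.construct C (y m)" for m
  have lin: "Vector_Spaces.linear (*s) (*s) (\<phi> m)" for m
    unfolding \<phi>_def by (rule vec.linear_construct[OF C(2)])
  have \<phi>: "\<phi> m b = y m b" if "b \<in> C" for m b
    unfolding \<phi>_def using that by (rule vec.construct_basis[OF C(2)])
  \<comment> \<open>Convergence to the identity extends from the basis \<open>C\<close> to all
    vectors by linearity.\<close>
  have "vec.subspace {v. (\<lambda>m. \<phi> m v) \<longlonglongrightarrow> v}"
    unfolding vec.subspace_def
    by (simp add: vec.linear_0[OF lin] vec.linear_add[OF lin] vec.linear_scale[OF lin]
        tendsto_add tendsto_vector_smult)
  then have "vec.span C \<subseteq> {v. (\<lambda>m. \<phi> m v) \<longlonglongrightarrow> v}"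
    using \<phi> y by (intro vec.span_minimal) auto
  then have conv: "(\<lambda>m. \<phi> m v) \<longlonglongrightarrow> v" for v using C(3) by auto
  have "(\<lambda>m. det (matrix (\<phi> m))) \<longlonglongrightarrow> det (mat 1 :: 'a ^ 'n ^ 'n)"
  proof (rule tendsto_det)
    fix i j :: 'n
    have "(\<lambda>m. \<phi> m (axis j 1) $ i) \<longlonglongrightarrow> axis j 1 $ i"
      by (rule tendsto_vec_nth[OF conv])
    then show "(\<lambda>m. matrix (\<phi> m) $ i $ j) \<longlonglongrightarrow> (mat 1 :: 'a ^ 'n ^ 'n) $ i $ j"
      by (simp add: matrix_def mat_def axis_def)
  qed
  then have "\<forall>\<^sub>F m in sequentially. det (matrix (\<phi> m)) \<noteq> 0"
    by (rule tendsto_imp_eventually_ne) simp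
  then obtain m where "det (matrix (\<phi> m)) \<noteq> 0"
    by (auto simp: eventually_sequentially)
  then have "inj (\<phi> m)"
    by (metis invertible_det_nz inj_matrix_vector_mult matrix_works[OF lin] ext)
  then have "vec.dim B = vec.dim (\<phi> m ` B)"
    using vec.dim_image_eq[OF lin] by (metis inj_on_subset subset_UNIV)
  also have "\<dots> \<le> vec.dim (X m)"
    using \<phi> x(1) B(1) C(1) by (intro vec.dim_subset) (auto simp: y_def subset_iff)
  finally show ?thesis
    using vec.dim_eq_card_independent[OF B(2)] B(4) by (intro exI[of _ m]) simp
qed

section \<open>Border rank\<close>

text \<open>The sort covers the real and complex fields at once; \<open>heine_borel\<close> supplies
  the compact unit sphere behind the limit subspace.\<close>

lemma dimension_spreading_imp_border_rank_ge:
  fixes A :: "'d::finite \<Rightarrow> 'a::{real_normed_field,heine_borel} ^ 'n ^ 'n"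
  assumes spread: "dimension_spreading s t A" and s: "s \<le> CARD('n)" and "0 < t"
  shows "CARD('n) + t \<le> border_rank (matrices_tensor A) + s"
proof -
  define r where "r = border_rank (matrices_tensor A)"
  obtain X :: "nat \<Rightarrow> ('a, 'd, 'n, 'n) tensor"
    where rank: "\<And>m. tensor_rank (X m) \<le> r" and X: "X \<longlonglongrightarrow> matrices_tensor A"
    using LeastI_ex[OF ex_border_rank_bound[of "matrices_tensor A"]]
    unfolding r_def border_rank_def by blast
  define B where "B m i = (\<chi> j k. X m i j k)" for m i
  have XB: "X m = matrices_tensor (B m)" for m
    by (simp add: matrices_tensor_def B_def)
  have conv: "(\<lambda>m. B m i $ j $ k) \<longlonglongrightarrow> A i $ j $ k" for i j k
  proof -
    \<comment> \<open>Tensors are curried, so evaluation at an entry is three successive coordinate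
      projections.\<close>
    have "continuous_on UNIV (\<lambda>T :: ('a, 'd, 'n, 'n) tensor. T i j k)"
      by (rule continuous_on_product_then_coordinatewise
          [OF continuous_on_product_then_coordinatewise[OF continuous_on_product_coordinates]])
    from continuous_on_tendsto_compose[OF this X] show ?thesis
      by (simp add: B_def matrices_tensor_def)
  qed
  define im where "im M U = {\<Sum>i\<in>UNIV. M i *v u i |u. \<forall>i. u i \<in> U}"
    for M :: "'d \<Rightarrow> 'a ^ 'n ^ 'n" and U
  have "\<exists>U. vec.subspace U \<and> s \<le> vec.dim U \<and> vec.dim (im (B m) U) \<le> r - (CARD('n) - s)" for m
  proof -
    have "sum_of_rank_ones (tensor_rank (X m)) (matrices_tensor (B m))"
      unfolding XB[symmetric] by (rule sum_of_rank_ones_tensor_rank)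
    then obtain U where "vec.subspace U" "s \<le> vec.dim U"
      "vec.dim (im (B m) U) \<le> tensor_rank (X m) - (CARD('n) - s)"
      unfolding im_def using sum_of_rank_ones_imp_small_image s by blast
    then show ?thesis using rank[of m] by (intro exI[of _ U]) linarith
  qed
  then obtain U where U: "\<And>m. vec.subspace (U m)" "\<And>m. s \<le> vec.dim (U m)"
    "\<And>m. vec.dim (im (B m) (U m)) \<le> r - (CARD('n) - s)"
    by metis
  obtain \<sigma> V where \<sigma>: "strict_mono (\<sigma> :: nat \<Rightarrow> nat)" and V: "vec.subspace V" "vec.dim V = s"
    and lim: "\<forall>v\<in>V. \<exists>x. (\<forall>m. x m \<in> U (\<sigma> m)) \<and> x \<longlonglongrightarrow> v"
    by (rule subspace_sequence_subconverges[of U, OF U(1,2)])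
  have "\<exists>m. vec.dim (im A V) \<le> vec.dim (im (B (\<sigma> m)) (U (\<sigma> m)))"
  proof (rule dim_lower_semicontinuous)
    fix w assume "w \<in> im A V"
    then obtain u where u: "\<And>i. u i \<in> V" and w: "w = (\<Sum>i\<in>UNIV. A i *v u i)"
      by (auto simp: im_def)
    obtain x where x: "\<And>i m. x i m \<in> U (\<sigma> m)" "\<And>i. x i \<longlonglongrightarrow> u i"
      using bspec[OF lim u] by metis
    have "(\<lambda>m. \<Sum>i\<in>UNIV. B (\<sigma> m) i *v x i m) \<longlonglongrightarrow> w"
      unfolding w
      by (intro tendsto_sum tendsto_matrix_vector_mult x(2)
          LIMSEQ_subseq_LIMSEQ[OF conv \<sigma>, unfolded o_def])
    moreover have "(\<Sum>i\<in>UNIV. B (\<sigma> m) i *v x i m) \<in> im (B (\<sigma> m)) (U (\<sigma> m))" for m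
      unfolding im_def by (intro CollectI exI[of _ "\<lambda>i. x i m"]) (simp add: x(1))
    ultimately show "\<exists>y. (\<forall>m. y m \<in> im (B (\<sigma> m)) (U (\<sigma> m))) \<and> y \<longlonglongrightarrow> w" 
      by (intro exI[of _ "\<lambda>m. \<Sum>i\<in>UNIV. B (\<sigma> m) i *v x i m"]) simp
  qed
  then obtain m where "vec.dim (im A V) \<le> vec.dim (im (B (\<sigma> m)) (U (\<sigma> m)))" by blast
  moreover have "t \<le> vec.dim (im A V)"
    using spread V by (simp add: dimension_spreading_def im_def)
  ultimately have "t \<le> r - (CARD('n) - s)"
    using U(3)[of "\<sigma> m"] by linarith
  then show ?thesis using s \<open>0 < t\<close> unfolding r_def by linarith
qed

text \<open>Both hypotheses exclude degenerate cases: for \<open>s > CARD('n)\<close> spreading is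
  vacuous for every \<open>t\<close>, and for \<open>t = 0\<close> even zero matrices are spreading.
  Integers make the difference a genuine one.\<close>

theorem theorem1:
  fixes s t :: nat
  assumes "s \<le> CARD('n::finite)" and "0 < t"
  shows "(\<forall>A :: 'd::finite \<Rightarrow> 'a::field ^ 'n ^ 'n. dimension_spreading s t A \<longrightarrow>
            int CARD('n) + int t - int s \<le> int (tensor_rank (matrices_tensor A))) \<and>
         (\<forall>A :: 'd \<Rightarrow> real ^ 'n ^ 'n. dimension_spreading s t A \<longrightarrow>
            int CARD('n) + int t - int s \<le> int (border_rank (matrices_tensor A))) \<and>
         (\<forall>A :: 'd \<Rightarrow> complex ^ 'n ^ 'n. dimension_spreading s t A \<longrightarrow>
            int CARD('n) + int t - int s \<le> int (border_rank (matrices_tensor A)))"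
proof (intro conjI allI impI)
  fix A :: "'d \<Rightarrow> 'a ^ 'n ^ 'n"
  assume "dimension_spreading s t A"
  from dimension_spreading_imp_tensor_rank_ge[OF this assms]
  show "int CARD('n) + int t - int s \<le> int (tensor_rank (matrices_tensor A))" by linarith
next
  fix A :: "'d \<Rightarrow> real ^ 'n ^ 'n"
  assume "dimension_spreading s t A"
  from dimension_spreading_imp_border_rank_ge[OF this assms]
  show "int CARD('n) + int t - int s \<le> int (border_rank (matrices_tensor A))" by linarith
next
  fix A :: "'d \<Rightarrow> complex ^ 'n ^ 'n"
  assume "dimension_spreading s t A"
  from dimension_spreading_imp_border_rank_ge[OF this assms]
  show "int CARD('n) + int t - int s \<le> int (border_rank (matrices_tensor A))" by linarith
qed

end
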